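(* Let $(A,\mu)\in\mathcal C$, let $(M,\bullet)$ be an $A$-bimodule algebra, let $\lambda\in R$ and let $\mathfrak R:M\to A$ be a relative Rota-Baxter operator of weight $\lambda$. On $M$, define the following products, for $m,m'\in M$: $$m\prec m':=m\cdot\mathfrak R(m'),\quad m\succ m':=\mathfrak R(m)\cdot m',\quad m\vee m':=\lambda\, m\bullet m'.$$ Then $(M,\prec,\succ,\vee)$ is a $\mathcal C$-NS-algebra.
   Context: Fix a commutative ring $R$; all modules, tensor products and linear maps are over $R$. An algebra $(A,\mu_1,\dots,\mu_s)$ is an $R$-module $A$ with linear maps (products) $\mu_i:A\otimes A\to A$; no associativity or unit is assumed. For a single product write $ab=\mu(a\otimes b)$. Fix a collection of multilinear relations $\mathcal R_1=0,\dots,\mathcal R_k=0$ in one binary product: an $n$-linear relation is an $R$-linear combination of parenthesized (non-associative) monomials in $x_1,\dots,x_n$, each variable occurring exactly once in each monomial. $\mathcal C$ is the category of all algebras $(A,\mu)$ in which these relations hold for all substitutions of elements of $A$; $(A,\mu)\in\mathcal C$ means that $(A,\mu)$ satisfies all of them. Bimodule algebra: let $(A,\mu)\in\mathcal C$ and let $M$ be an $R$-module with a product $\bullet:M\otimes M\to M$ and linear maps $l,r:A\to\mathrm{End}(M)$, written $a\cdot m:=l(a)(m)$ and $m\cdot a:=r(a)(m)$ (left and right actions). $(M,\bullet,l,r)$, or simply $(M,\bullet)$, is an $A$-bimodule algebra if $A\oplus M$ with the product $(a,m)*_\bullet(a',m'):=(aa',a\cdot m'+m\cdot a'+m\bullet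 m')$ belongs to $\mathcal C$. Relative Rota-Baxter operator of weight $\lambda\in R$ on the $A$-bimodule algebra $(M,\bullet)$: a linear map $\mathfrak R:M\to A$ with $\mathfrak R(m)\mathfrak R(m')=\mathfrak R(\mathfrak R(m)\cdot m'+m\cdot\mathfrak R(m')+\lambda\, m\bullet m')$ for all $m,m'\in M$. $\mathcal C$-NS-algebra: an algebra $(A,\prec,\succ,\vee)$ with three products such that $(A\oplus A,\boxtimes)\in\mathcal C$, where $(a,x)\boxtimes(a',x'):=(a\star a',\,a\succ x'+x\prec a')$ and $a\star a':=a\succ a'+a\prec a'+a\vee a'$. *)

theory Defs
  imports "HOL-Algebra.Module" "HOL-Algebra.Chinese_Remainder"
begin

text \<open>
  Modules are those of HOL-Algebra. Their record type also has ring fields \<open>mult\<close> and \<open>one\<close>,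
  which the locale \<open>module\<close> does not constrain for the module argument; they are never used below.
  Products are passed as separate functions instead, and only their values on the carrier matter.
\<close>

definition linear_on ::
  "('r, 'x) ring_scheme \<Rightarrow> ('r, 'm, 'y) module_scheme \<Rightarrow> ('r, 'n, 'z) module_scheme \<Rightarrow> ('m \<Rightarrow> 'n) \<Rightarrow> bool"
where
  "linear_on R M N f \<longleftrightarrow>
     f \<in> carrier M \<rightarrow> carrier N \<and>
     (\<forall>x\<in>carrier M. \<forall>y\<in>carrier M. f (x \<oplus>\<^bsub>M\<^esub> y) = f x \<oplus>\<^bsub>N\<^esub> f y) \<and>
     (\<forall>c\<in>carrier R. \<forall>x\<in>carrier M. f (c \<odot>\<^bsub>M\<^esub> x) = c \<odot>\<^bsub>N\<^esub> f x)"

text \<open>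
  Linear maps \<open>M \<otimes> N \<rightarrow> P\<close> are rendered as bilinear maps. With \<open>N = P\<close>, the same notion renders a
  linear map \<open>M \<rightarrow> End N\<close>.
\<close>

definition bilinear_on ::
  "('r, 'x) ring_scheme \<Rightarrow> ('r, 'm, 'y) module_scheme \<Rightarrow> ('r, 'n, 'z) module_scheme \<Rightarrow>
   ('r, 'p, 'w) module_scheme \<Rightarrow> ('m \<Rightarrow> 'n \<Rightarrow> 'p) \<Rightarrow> bool"
where
  "bilinear_on R M N P b \<longleftrightarrow>
     (\<forall>x\<in>carrier M. linear_on R N P (\<lambda>y. b x y)) \<and>
     (\<forall>y\<in>carrier N. linear_on R M P (\<lambda>x. b x y))"

definition module_sum ::
  "('r, 'm, 'y) module_scheme \<Rightarrow> ('r, 'n, 'z) module_scheme \<Rightarrow> ('r, 'm \<times> 'n) module"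
where
  "module_sum M N =
     ring.extend (RDirProd M N) (module.fields (\<lambda>c (x, y). (c \<odot>\<^bsub>M\<^esub> x, c \<odot>\<^bsub>N\<^esub> y)))"

lemma module_sum_simps [simp]:
  "carrier (module_sum M N) = carrier M \<times> carrier N"
  "(x, y) \<oplus>\<^bsub>module_sum M N\<^esub> (x', y') = (x \<oplus>\<^bsub>M\<^esub> x', y \<oplus>\<^bsub>N\<^esub> y')"
  "\<zero>\<^bsub>module_sum M N\<^esub> = (\<zero>\<^bsub>M\<^esub>, \<zero>\<^bsub>N\<^esub>)"
  "c \<odot>\<^bsub>module_sum M N\<^esub> (x, y) = (c \<odot>\<^bsub>M\<^esub> x, c \<odot>\<^bsub>N\<^esub> y)"
  by (simp_all add: module_sum_def RDirProd_def DirProd_def ring.defs monoid.defs module.defs)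

definition nonassoc_algebra ::
  "('r, 'x) ring_scheme \<Rightarrow> ('r, 'a, 'y) module_scheme \<Rightarrow> ('a \<Rightarrow> 'a \<Rightarrow> 'a) list \<Rightarrow> bool"
where
  "nonassoc_algebra R A \<mu>s \<longleftrightarrow> module R A \<and> (\<forall>\<mu>\<in>set \<mu>s. bilinear_on R A A A \<mu>)"

datatype monomial = Var nat | Prod monomial monomial

primrec vars :: "monomial \<Rightarrow> nat list" where
  "vars (Var i) = [i]"
| "vars (Prod s t) = vars s @ vars t"

primrec eval_monomial :: "('a \<Rightarrow> 'a \<Rightarrow> 'a) \<Rightarrow> (nat \<Rightarrow> 'a) \<Rightarrow> monomial \<Rightarrow> 'a" where
  "eval_monomial \<mu> v (Var i) = v i"
| "eval_monomial \<mu> v (Prod s t) = \<mu> (eval_monomial \<mu> v s) (eval_monomial \<mu> v t)"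

text \<open>A formal linear combination of monomials is a list of pairs of a coefficient and a monomial.\<close>

type_synonym 'r relation = "('r \<times> monomial) list"

definition multilinear_relation :: "('r, 'x) ring_scheme \<Rightarrow> nat \<Rightarrow> 'r relation \<Rightarrow> bool" where
  "multilinear_relation R n p \<longleftrightarrow>
     (\<forall>(c, t)\<in>set p. c \<in> carrier R \<and> distinct (vars t) \<and> set (vars t) = {1..n})"

definition eval_relation ::
  "('r, 'a, 'y) module_scheme \<Rightarrow> ('a \<Rightarrow> 'a \<Rightarrow> 'a) \<Rightarrow> (nat \<Rightarrow> 'a) \<Rightarrow> 'r relation \<Rightarrow> 'a"
where
  "eval_relation A \<mu> v p =
     foldr (\<lambda>(c, t) s. c \<odot>\<^bsub>A\<^esub> eval_monomial \<mu> v t \<oplus>\<^bsub>A\<^esub> s) p \<zero>\<^bsub>A\<^esub>"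

text \<open>Membership of \<open>(A, \<mu>)\<close> in the category \<open>\<C>\<close> determined by the list \<open>Rs\<close> of relations.\<close>

definition in_category ::
  "('r, 'x) ring_scheme \<Rightarrow> 'r relation list \<Rightarrow> ('r, 'a, 'y) module_scheme \<Rightarrow> ('a \<Rightarrow> 'a \<Rightarrow> 'a) \<Rightarrow> bool"
where
  "in_category R Rs A \<mu> \<longleftrightarrow>
     nonassoc_algebra R A [\<mu>] \<and>
     (\<forall>p\<in>set Rs. \<forall>v. (\<forall>i. v i \<in> carrier A) \<longrightarrow> eval_relation A \<mu> v p = \<zero>\<^bsub>A\<^esub>)"

text \<open>Here \<open>l a m\<close> is \<open>a \<cdot> m\<close>, and \<open>r a m\<close> is \<open>m \<cdot> a\<close>.\<close>

definition semidirect_product ::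
  "('r, 'm, 'z) module_scheme \<Rightarrow> ('a \<Rightarrow> 'a \<Rightarrow> 'a) \<Rightarrow> ('m \<Rightarrow> 'm \<Rightarrow> 'm) \<Rightarrow>
   ('a \<Rightarrow> 'm \<Rightarrow> 'm) \<Rightarrow> ('a \<Rightarrow> 'm \<Rightarrow> 'm) \<Rightarrow> 'a \<times> 'm \<Rightarrow> 'a \<times> 'm \<Rightarrow> 'a \<times> 'm"
where
  "semidirect_product M \<mu> bul l r =
     (\<lambda>(a, m) (a', m'). (\<mu> a a', l a m' \<oplus>\<^bsub>M\<^esub> r a' m \<oplus>\<^bsub>M\<^esub> bul m m'))"

definition bimodule_algebra ::
  "('r, 'x) ring_scheme \<Rightarrow> 'r relation list \<Rightarrow> ('r, 'a, 'y) module_scheme \<Rightarrow> ('a \<Rightarrow> 'a \<Rightarrow> 'a) \<Rightarrow>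
   ('r, 'm, 'z) module_scheme \<Rightarrow> ('m \<Rightarrow> 'm \<Rightarrow> 'm) \<Rightarrow>
   ('a \<Rightarrow> 'm \<Rightarrow> 'm) \<Rightarrow> ('a \<Rightarrow> 'm \<Rightarrow> 'm) \<Rightarrow> bool"
where
  "bimodule_algebra R Rs A \<mu> M bul l r \<longleftrightarrow>
     nonassoc_algebra R M [bul] \<and>
     bilinear_on R A M M l \<and> bilinear_on R A M M r \<and>
     in_category R Rs (module_sum A M) (semidirect_product M \<mu> bul l r)"

definition relative_Rota_Baxter ::
  "('r, 'x) ring_scheme \<Rightarrow> ('r, 'a, 'y) module_scheme \<Rightarrow> ('a \<Rightarrow> 'a \<Rightarrow> 'a) \<Rightarrow>
   ('r, 'm, 'z) module_scheme \<Rightarrow> ('m \<Rightarrow> 'm \<Rightarrow> 'm) \<Rightarrow>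
   ('a \<Rightarrow> 'm \<Rightarrow> 'm) \<Rightarrow> ('a \<Rightarrow> 'm \<Rightarrow> 'm) \<Rightarrow> 'r \<Rightarrow> ('m \<Rightarrow> 'a) \<Rightarrow> bool"
where
  "relative_Rota_Baxter R A \<mu> M bul l r w \<RR> \<longleftrightarrow>
     linear_on R M A \<RR> \<and>
     (\<forall>m\<in>carrier M. \<forall>m'\<in>carrier M.
        \<mu> (\<RR> m) (\<RR> m') =
        \<RR> (l (\<RR> m) m' \<oplus>\<^bsub>M\<^esub> r (\<RR> m') m \<oplus>\<^bsub>M\<^esub> w \<odot>\<^bsub>M\<^esub> bul m m'))"

definition NS_algebra ::
  "('r, 'x) ring_scheme \<Rightarrow> 'r relation list \<Rightarrow> ('r, 'a, 'y) module_scheme \<Rightarrow>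
   ('a \<Rightarrow> 'a \<Rightarrow> 'a) \<Rightarrow> ('a \<Rightarrow> 'a \<Rightarrow> 'a) \<Rightarrow> ('a \<Rightarrow> 'a \<Rightarrow> 'a) \<Rightarrow> bool"
where
  "NS_algebra R Rs A prec succ vee \<longleftrightarrow>
     nonassoc_algebra R A [prec, succ, vee] \<and>
     in_category R Rs (module_sum A A)
       (\<lambda>(a, x) (a', x'). (succ a a' \<oplus>\<^bsub>A\<^esub> prec a a' \<oplus>\<^bsub>A\<^esub> vee a a', succ a x' \<oplus>\<^bsub>A\<^esub> prec x a'))"

end

theory Submission
  imports Defs
begin

text \<open>
  Write \<open>*\<^sub>w\<close> for the product on \<open>A \<oplus> M\<close> built from \<open>w \<bullet>\<close>. A multilinear relation holds as soon as it
  holds at arguments each lying in \<open>A\<close> or in \<open>M\<close>. At such arguments, if \<open>k \<ge> 1\<close> of them lie in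
  \<open>M\<close>, then every monomial for \<open>*\<^sub>w\<close> is \<open>w\<^bsup>k-1\<^esup>\<close> times the same monomial for \<open>*\<^sub>1\<close>;
  hence \<open>(A \<oplus> M, *\<^sub>w)\<close> belongs to the category for every \<open>w\<close>. The Rota-Baxter identity says
  that \<open>(m, x) \<mapsto> (\<RR> m, m)\<close> and \<open>(m, x) \<mapsto> (\<RR> m, x)\<close> are homomorphisms from \<open>M \<oplus> M\<close> to
  \<open>(A \<oplus> M, *\<^sub>\<lambda>)\<close> and \<open>(A \<oplus> M, *\<^sub>0)\<close>. They are jointly injective, so the relations
  pull back to \<open>M \<oplus> M\<close>.
\<close>

section \<open>Linear and bilinear maps\<close>

lemma linear_onD:
  assumes "linear_on R M N f"
  shows linear_on_closed: "x \<in> carrier M \<Longrightarrow> f x \<in> carrier N"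
    and linear_on_add: "x \<in> carrier M \<Longrightarrow> y \<in> carrier M \<Longrightarrow> f (x \<oplus>\<^bsub>M\<^esub> y) = f x \<oplus>\<^bsub>N\<^esub> f y"
    and linear_on_smult: "c \<in> carrier R \<Longrightarrow> x \<in> carrier M \<Longrightarrow> f (c \<odot>\<^bsub>M\<^esub> x) = c \<odot>\<^bsub>N\<^esub> f x"
  using assms unfolding linear_on_def by auto

text \<open>Homogeneity at the zero scalar, which kills every vector on both sides.\<close>

lemma linear_on_zero:
  assumes "module R M" "module R N" "linear_on R M N f"
  shows "f \<zero>\<^bsub>M\<^esub> = \<zero>\<^bsub>N\<^esub>"
proof -
  interpret M: module R M by fact
  interpret N: module R N by fact
  have "f (\<zero>\<^bsub>R\<^esub> \<odot>\<^bsub>M\<^esub> \<zero>\<^bsub>M\<^esub>) = \<zero>\<^bsub>R\<^esub> \<odot>\<^bsub>N\<^esub> f \<zero>\<^bsub>M\<^esub>"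
    by (rule linear_on_smult[OF assms(3)]) auto
  then show ?thesis
    using linear_on_closed[OF assms(3)] by simp
qed

lemma linear_on_compose:
  "linear_on R M N f \<Longrightarrow> linear_on R N P g \<Longrightarrow> linear_on R M P (\<lambda>x. g (f x))"
  unfolding linear_on_def by (auto simp: Pi_iff)

lemma linear_on_id: "linear_on R M M (\<lambda>x. x)"
  unfolding linear_on_def by auto

lemma linear_on_plus:
  assumes "module R N" and f: "linear_on R M N f" and g: "linear_on R M N g"
  shows "linear_on R M N (\<lambda>x. f x \<oplus>\<^bsub>N\<^esub> g x)"
proof -
  interpret N: module R N by fact
  show ?thesis
    using linear_on_closed[OF f] linear_on_closed[OF g]
    unfolding linear_on_def
    by (auto simp: linear_onD[OF f] linear_onD[OF g] N.smult_r_distr N.a_ac)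
qed

text \<open>Commutativity of \<open>R\<close> enters here: \<open>c\<close> must be moved past the
  scalar that \<open>f\<close> pulls out.\<close>

lemma linear_on_scale:
  assumes "module R N" and f: "linear_on R M N f" and c: "c \<in> carrier R"
  shows "linear_on R M N (\<lambda>x. c \<odot>\<^bsub>N\<^esub> f x)"
proof -
  interpret N: module R N by fact
  show ?thesis
    using linear_on_closed[OF f] c unfolding linear_on_def
    by (auto simp: linear_onD[OF f] N.smult_r_distr N.R.m_comm simp flip: N.smult_assoc1)
qed

lemma linear_on_fst: "linear_on R (module_sum M N) M fst"
  and linear_on_snd: "linear_on R (module_sum M N) N snd"
  unfolding linear_on_def by auto

lemma linear_on_Pair:
  "linear_on R X M f \<Longrightarrow> linear_on R X N g \<Longrightarrow> linear_on R X (module_sum M N) (\<lambda>x. (f x, g x))"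
  unfolding linear_on_def by (auto simp: Pi_iff)

lemma bilinear_onD:
  assumes "bilinear_on R M N P b"
  shows bilinear_on_right: "x \<in> carrier M \<Longrightarrow> linear_on R N P (\<lambda>y. b x y)"
    and bilinear_on_left: "y \<in> carrier N \<Longrightarrow> linear_on R M P (\<lambda>x. b x y)"
  using assms unfolding bilinear_on_def by auto

lemma bilinear_on_closed:
  "bilinear_on R M N P b \<Longrightarrow> x \<in> carrier M \<Longrightarrow> y \<in> carrier N \<Longrightarrow> b x y \<in> carrier P"
  using bilinear_on_right linear_on_closed by metis

lemma bilinear_on_zero:
  assumes "module R M" "module R N" "module R P" "bilinear_on R M N P b"
  shows bilinear_on_zero_left: "y \<in> carrier N \<Longrightarrow> b \<zero>\<^bsub>M\<^esub> y = \<zero>\<^bsub>P\<^esub>"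
    and bilinear_on_zero_right: "x \<in> carrier M \<Longrightarrow> b x \<zero>\<^bsub>N\<^esub> = \<zero>\<^bsub>P\<^esub>"
  using linear_on_zero[OF assms(1,3) bilinear_on_left[OF assms(4)]]
    linear_on_zero[OF assms(2,3) bilinear_on_right[OF assms(4)]] by auto

lemma bilinear_on_smult:
  assumes "bilinear_on R M N P b" "c \<in> carrier R" "x \<in> carrier M" "y \<in> carrier N"
  shows bilinear_on_smult_left: "b (c \<odot>\<^bsub>M\<^esub> x) y = c \<odot>\<^bsub>P\<^esub> b x y"
    and bilinear_on_smult_right: "b x (c \<odot>\<^bsub>N\<^esub> y) = c \<odot>\<^bsub>P\<^esub> b x y"
  using linear_on_smult[OF bilinear_on_left[OF assms(1)]]
    linear_on_smult[OF bilinear_on_right[OF assms(1)]] assms by auto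

lemma bilinear_on_plus:
  "module R P \<Longrightarrow> bilinear_on R M N P b \<Longrightarrow> bilinear_on R M N P b' \<Longrightarrow>
    bilinear_on R M N P (\<lambda>x y. b x y \<oplus>\<^bsub>P\<^esub> b' x y)"
  unfolding bilinear_on_def by (simp add: linear_on_plus)

lemma bilinear_on_scale:
  "module R P \<Longrightarrow> bilinear_on R M N P b \<Longrightarrow> c \<in> carrier R \<Longrightarrow>
    bilinear_on R M N P (\<lambda>x y. c \<odot>\<^bsub>P\<^esub> b x y)"
  unfolding bilinear_on_def by (simp add: linear_on_scale)

lemma bilinear_on_Pair:
  "bilinear_on R X Y M b \<Longrightarrow> bilinear_on R X Y N b' \<Longrightarrow>
    bilinear_on R X Y (module_sum M N) (\<lambda>x y. (b x y, b' x y))"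
  unfolding bilinear_on_def by (simp add: linear_on_Pair)

text \<open>Each component of a product on a direct sum is a sum of bilinear maps precomposed with
  the projections; this lemma supplies the summands.\<close>

lemma bilinear_on_compose:
  assumes b: "bilinear_on R M N P b" and f: "linear_on R X M f" and g: "linear_on R Y N g"
  shows "bilinear_on R X Y P (\<lambda>x y. b (f x) (g y))"
  unfolding bilinear_on_def
  using linear_on_compose[OF f bilinear_on_left[OF b]] linear_on_compose[OF g bilinear_on_right[OF b]]
    linear_on_closed[OF f] linear_on_closed[OF g] by auto

lemma bilinear_on_flip: "bilinear_on R M N P b \<Longrightarrow> bilinear_on R N M P (\<lambda>x y. b y x)"
  unfolding bilinear_on_def by auto

lemma module_module_sum:
  assumes "module R M" "module R N"
  shows "module R (module_sum M N)"
proof -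
  interpret M: module R M by fact
  interpret N: module R N by fact
  have inverse: "\<exists>x'\<in>carrier M. \<exists>y'\<in>carrier N. x' \<oplus>\<^bsub>M\<^esub> x = \<zero>\<^bsub>M\<^esub> \<and> y' \<oplus>\<^bsub>N\<^esub> y = \<zero>\<^bsub>N\<^esub>"
    if "x \<in> carrier M" "y \<in> carrier N" for x y
    using that M.l_neg N.l_neg M.a_inv_closed N.a_inv_closed by blast
  have "abelian_group (module_sum M N)"
    by (rule abelian_groupI) (auto simp: M.a_ac N.a_ac inverse)
  then show ?thesis
    by (intro moduleI M.is_cring)
      (auto simp: M.smult_l_distr N.smult_l_distr M.smult_r_distr N.smult_r_distr
        M.smult_assoc1 N.smult_assoc1)
qed

section \<open>Evaluation of monomials and relations\<close>

lemma eval_relation_simps [simp]: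
  "eval_relation A \<mu> v [] = \<zero>\<^bsub>A\<^esub>"
  "eval_relation A \<mu> v ((c, t) # p) = c \<odot>\<^bsub>A\<^esub> eval_monomial \<mu> v t \<oplus>\<^bsub>A\<^esub> eval_relation A \<mu> v p"
  by (simp_all add: eval_relation_def)

lemma multilinear_relation_Cons:
  "multilinear_relation R n ((c, t) # p) \<longleftrightarrow>
    c \<in> carrier R \<and> distinct (vars t) \<and> set (vars t) = {1..n} \<and> multilinear_relation R n p"
  unfolding multilinear_relation_def by auto

lemma eval_monomial_closed:
  assumes "bilinear_on R A A A \<mu>" "\<And>i. v i \<in> carrier A"
  shows "eval_monomial \<mu> v t \<in> carrier A"
  using assms by (induction t) (auto intro: bilinear_on_closed)

lemma eval_relation_closed:
  assumes "module R A" "bilinear_on R A A A \<mu>" "\<And>i. v i \<in> carrier A" "multilinear_relation R n p"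
  shows "eval_relation A \<mu> v p \<in> carrier A"
proof -
  interpret module R A by fact
  show ?thesis
    using assms(4)
    by (induction p) (auto simp: multilinear_relation_Cons eval_monomial_closed[OF assms(2,3)])
qed

text \<open>Used for the factor of a product that does not contain an updated variable: it can be
  treated as a constant.\<close>

lemma eval_monomial_cong:
  "(\<And>i. i \<in> set (vars t) \<Longrightarrow> v i = v' i) \<Longrightarrow> eval_monomial \<mu> v t = eval_monomial \<mu> v' t"
proof (induction t)
  case (Prod s t)
  then have "eval_monomial \<mu> v s = eval_monomial \<mu> v' s" "eval_monomial \<mu> v t = eval_monomial \<mu> v' t"
    by auto
  then show ?case by simp
qed simp

text \<open>The variable \<open>i\<close> occurs exactly once, so at each product node only one
  factor depends on it, and bilinearity carries additivity of that factor up to the node.\<close>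

lemma eval_monomial_add:
  assumes b: "bilinear_on R A A A \<mu>" and v: "\<And>i. v i \<in> carrier A"
    and xy: "x \<in> carrier A" "y \<in> carrier A"
    and "distinct (vars t)" "i \<in> set (vars t)"
  shows "eval_monomial \<mu> (v(i := x \<oplus>\<^bsub>A\<^esub> y)) t =
    eval_monomial \<mu> (v(i := x)) t \<oplus>\<^bsub>A\<^esub> eval_monomial \<mu> (v(i := y)) t"
  using assms(5,6)
proof (induction t)
  case (Prod s t)
  have closed: "eval_monomial \<mu> (v(i := z)) u \<in> carrier A" if "z \<in> carrier A" for z u
    using that v by (intro eval_monomial_closed[OF b]) auto
  have unchanged: "eval_monomial \<mu> (v(i := z)) u = eval_monomial \<mu> (v(i := x)) u"
    if "i \<notin> set (vars u)" for z u
    using that by (intro eval_monomial_cong) auto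
  \<comment> \<open>Distinctness of the variables of \<open>Prod s t\<close> rules out that both
    factors contain \<open>i\<close>.\<close>
  consider "i \<in> set (vars s)" "i \<notin> set (vars t)" | "i \<notin> set (vars s)" "i \<in> set (vars t)"
    using Prod.prems by auto
  then show ?case
  proof cases
    case 1
    then show ?thesis
      using Prod unchanged[OF 1(2), of "x \<oplus>\<^bsub>A\<^esub> y"] unchanged[OF 1(2), of y]
      by (simp add: linear_on_add[OF bilinear_on_left[OF b]] closed xy del: fun_upd_apply)
  next
    case 2
    then show ?thesis
      using Prod unchanged[OF 2(1), of "x \<oplus>\<^bsub>A\<^esub> y"] unchanged[OF 2(1), of y]
      by (simp add: linear_on_add[OF bilinear_on_right[OF b]] closed xy del: fun_upd_apply)
  qed
qed simp

text \<open>Every monomial of an \<open>n\<close>-linear relation contains every variable with index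
  in \<open>{1..n}\<close>, so each term of the combination is additive in position
  \<open>i\<close>.\<close>

lemma eval_relation_add:
  assumes A: "module R A" and b: "bilinear_on R A A A \<mu>" and v: "\<And>i. v i \<in> carrier A"
    and xy: "x \<in> carrier A" "y \<in> carrier A"
    and "multilinear_relation R n p" and i: "i \<in> {1..n}"
  shows "eval_relation A \<mu> (v(i := x \<oplus>\<^bsub>A\<^esub> y)) p =
    eval_relation A \<mu> (v(i := x)) p \<oplus>\<^bsub>A\<^esub> eval_relation A \<mu> (v(i := y)) p"
proof -
  interpret module R A by fact
  show ?thesis
    using assms(6)
  proof (induction p)
    case (Cons a p)
    obtain c t where a: "a = (c, t)" by force
    have p: "multilinear_relation R n p" "c \<in> carrier R"
      and t: "distinct (vars t)" "set (vars t) = {1..n}"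
      using Cons.prems by (auto simp: a multilinear_relation_Cons)
    have v': "(v(i := z)) j \<in> carrier A" if "z \<in> carrier A" for z j
      using that v by auto
    note closed = eval_monomial_closed[OF b v'] eval_relation_closed[OF A b v' p(1)]
    show ?case
      using Cons.IH[OF p(1)] eval_monomial_add[where v = v, OF b v xy t(1), of i] i t(2) p(2)
      by (simp add: a closed xy smult_r_distr a_ac del: fun_upd_apply)
  qed simp
qed

lemma eval_monomial_hom:
  assumes b: "bilinear_on R A A A \<mu>" and v: "\<And>i. v i \<in> carrier A"
    and hom: "\<And>x y. x \<in> carrier A \<Longrightarrow> y \<in> carrier A \<Longrightarrow> f (\<mu> x y) = \<mu>' (f x) (f y)"
  shows "f (eval_monomial \<mu> v t) = eval_monomial \<mu>' (\<lambda>i. f (v i)) t"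
  by (induction t) (auto simp: hom eval_monomial_closed[OF b v])

text \<open>Multiplicativity of \<open>f\<close> handles the monomials and linearity handles their
  combination. Relations known in \<open>B\<close> can then be pulled back along
  \<open>f\<close>.\<close>

lemma eval_relation_hom:
  assumes A: "module R A" and B: "module R B" and b: "bilinear_on R A A A \<mu>"
    and v: "\<And>i. v i \<in> carrier A" and f: "linear_on R A B f"
    and hom: "\<And>x y. x \<in> carrier A \<Longrightarrow> y \<in> carrier A \<Longrightarrow> f (\<mu> x y) = \<mu>' (f x) (f y)"
    and "multilinear_relation R n p"
  shows "f (eval_relation A \<mu> v p) = eval_relation B \<mu>' (\<lambda>i. f (v i)) p"
proof -
  interpret module R A by fact
  show ?thesis
    using assms(7)
  proof (induction p)
    case Nil
    then show ?case by (simp add: linear_on_zero[OF A B f])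
  next
    case (Cons a p)
    obtain c t where a: "a = (c, t)" by force
    have p: "multilinear_relation R n p" "c \<in> carrier R"
      using Cons.prems by (auto simp: a multilinear_relation_Cons)
    show ?case
      using Cons.IH[OF p(1)] p(2) eval_monomial_hom[OF b v, where f = f and \<mu>' = \<mu>', OF hom]
      by (simp add: a linear_onD[OF f] eval_monomial_closed[OF b v] eval_relation_closed[OF A b v p(1)])
  qed
qed

text \<open>Splitting each argument as \<open>(a, 0) + (0, m)\<close> and expanding by additivity
  leaves only values at pure arguments.\<close>

lemma eval_relation_module_sum_pure:
  fixes A :: "('r, 'a, 'y) module_scheme" and M :: "('r, 'm, 'z) module_scheme"
  assumes A: "module R A" and M: "module R M"
    and b: "bilinear_on R (module_sum A M) (module_sum A M) (module_sum A M) \<mu>"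
    and p: "multilinear_relation R n p"
    and pure: "\<And>v. (\<And>i. v i \<in> carrier (module_sum A M)) \<Longrightarrow>
      (\<And>i. i \<in> {1..n} \<Longrightarrow> fst (v i) = \<zero>\<^bsub>A\<^esub> \<or> snd (v i) = \<zero>\<^bsub>M\<^esub>) \<Longrightarrow>
      eval_relation (module_sum A M) \<mu> v p = \<zero>\<^bsub>module_sum A M\<^esub>"
    and v: "\<And>i. v i \<in> carrier (module_sum A M)"
  shows "eval_relation (module_sum A M) \<mu> v p = \<zero>\<^bsub>module_sum A M\<^esub>"
proof -
  interpret A: module R A by fact
  interpret M: module R M by fact
  interpret S: module R "module_sum A M" by (rule module_module_sum[OF A M])
  \<comment> \<open>The set \<open>T\<close> holds the positions at which mixed arguments are still
    allowed; the induction removes them one at a time.\<close>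
  have "eval_relation (module_sum A M) \<mu> v p = \<zero>\<^bsub>module_sum A M\<^esub>"
    if "finite T" "\<And>i. v i \<in> carrier (module_sum A M)"
      "\<And>i. i \<in> {1..n} - T \<Longrightarrow> fst (v i) = \<zero>\<^bsub>A\<^esub> \<or> snd (v i) = \<zero>\<^bsub>M\<^esub>" for T v
    using that
  proof (induction T arbitrary: v)
    case empty
    then show ?case by (intro pure) auto
  next
    case (insert i T)
    show ?case
    proof (cases "i \<in> {1..n}")
      case True
      define x where "x = (fst (v i), \<zero>\<^bsub>M\<^esub>)"
      define y where "y = (\<zero>\<^bsub>A\<^esub>, snd (v i))"
      have vi: "fst (v i) \<in> carrier A" "snd (v i) \<in> carrier M"
        using insert.prems(1)[of i] by auto
      then have xy: "x \<in> carrier (module_sum A M)" "y \<in> carrier (module_sum A M)"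
        by (auto simp: x_def y_def)
      have "x \<oplus>\<^bsub>module_sum A M\<^esub> y = v i"
        using vi by (simp add: x_def y_def)
      then have "eval_relation (module_sum A M) \<mu> v p =
          eval_relation (module_sum A M) \<mu> (v(i := x)) p \<oplus>\<^bsub>module_sum A M\<^esub>
          eval_relation (module_sum A M) \<mu> (v(i := y)) p"
        using eval_relation_add[where v = v, OF S.module_axioms b insert.prems(1) xy p True] by simp
      moreover have "eval_relation (module_sum A M) \<mu> (v(i := x)) p = \<zero>\<^bsub>module_sum A M\<^esub>"
        using insert.prems xy by (intro insert.IH) (auto simp: x_def)
      moreover have "eval_relation (module_sum A M) \<mu> (v(i := y)) p = \<zero>\<^bsub>module_sum A M\<^esub>"
        using insert.prems xy by (intro insert.IH) (auto simp: y_def)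
      ultimately show ?thesis by simp
    next
      \<comment> \<open>A position outside \<open>{1..n}\<close> is under no purity condition, so
        the induction hypothesis applies to \<open>v\<close> itself.\<close>
      case False
      then show ?thesis using insert.prems by (intro insert.IH) auto
    qed
  qed
  \<comment> \<open>For \<open>T = {1..n}\<close> the purity condition is vacuous.\<close>
  from this[of "{1..n}"] v show ?thesis by auto
qed

section \<open>Rescaling the product of a bimodule algebra\<close>

lemma bilinear_on_semidirect_product:
  assumes "module R M" "bilinear_on R A A A \<mu>" "bilinear_on R A M M l" "bilinear_on R A M M r"
    "bilinear_on R M M M bul"
  shows "bilinear_on R (module_sum A M) (module_sum A M) (module_sum A M)
    (semidirect_product M \<mu> bul l r)"
proof -
  \<comment> \<open>Projections replace pattern matching, so that each summand has the shape
    required by \<open>bilinear_on_compose\<close>.\<close>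
  have eq: "semidirect_product M \<mu> bul l r =
      (\<lambda>x y. (\<mu> (fst x) (fst y),
        l (fst x) (snd y) \<oplus>\<^bsub>M\<^esub> r (fst y) (snd x) \<oplus>\<^bsub>M\<^esub> bul (snd x) (snd y)))"
    by (auto simp: semidirect_product_def fun_eq_iff)
  \<comment> \<open>The right action takes the algebra element as its first argument although that
    element comes from the right factor \<open>y\<close>; hence the flip.\<close>
  have r: "bilinear_on R (module_sum A M) (module_sum A M) M (\<lambda>x y. r (fst y) (snd x))"
    using bilinear_on_compose[OF bilinear_on_flip[OF assms(4)] linear_on_snd linear_on_fst] .
  show ?thesis
    unfolding eq
    by (intro bilinear_on_Pair bilinear_on_plus assms(1) r
        bilinear_on_compose[OF assms(2) linear_on_fst linear_on_fst]
        bilinear_on_compose[OF assms(3) linear_on_fst linear_on_snd]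
        bilinear_on_compose[OF assms(5) linear_on_snd linear_on_snd])
qed

text \<open>On a monomial value at pure arguments this agrees with scaling the whole pair by
  \<open>w^(k-1)\<close>: for \<open>k = 0\<close> the factor is \<open>1\<close>, and for
  \<open>k > 0\<close> the \<open>A\<close>-component is zero.\<close>

definition scale_snd ::
  "('r, 'm, 'z) module_scheme \<Rightarrow> 'r \<Rightarrow> 'a \<times> 'm \<Rightarrow> 'a \<times> 'm" where
  "scale_snd M c = (\<lambda>(a, m). (a, c \<odot>\<^bsub>M\<^esub> m))"

text \<open>For \<open>k = 0\<close> the truncated exponent \<open>k - 1\<close> makes the scaling factor \<open>1\<close>.\<close>

lemma eval_monomial_scaled:
  fixes A :: "('r, 'a, 'y) module_scheme" and M :: "('r, 'm, 'z) module_scheme"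
  assumes A: "module R A" and M: "module R M"
    and \<mu>: "bilinear_on R A A A \<mu>" and l: "bilinear_on R A M M l" and r: "bilinear_on R A M M r"
    and bul: "bilinear_on R M M M bul" and w: "w \<in> carrier R"
    and v: "\<And>i. v i \<in> carrier (module_sum A M)"
    and "distinct (vars t)"
    and "\<And>i. i \<in> set (vars t) \<Longrightarrow> i \<in> S \<Longrightarrow> fst (v i) = \<zero>\<^bsub>A\<^esub>"
    and "\<And>i. i \<in> set (vars t) \<Longrightarrow> i \<notin> S \<Longrightarrow> snd (v i) = \<zero>\<^bsub>M\<^esub>"
  defines "e \<equiv> eval_monomial (semidirect_product M \<mu> bul l r) v"
    and "e' \<equiv> eval_monomial (semidirect_product M \<mu> (\<lambda>m m'. w \<odot>\<^bsub>M\<^esub> bul m m') l r) v"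
    and "k \<equiv> \<lambda>t. card (set (vars t) \<inter> S)"
  shows "e' t = scale_snd M (w [^]\<^bsub>R\<^esub> (k t - 1)) (e t) \<and>
    (if k t = 0 then snd (e t) = \<zero>\<^bsub>M\<^esub> else fst (e t) = \<zero>\<^bsub>A\<^esub>)"
  using assms(9-11)
\<comment> \<open>The second conjunct, locating the value in \<open>A\<close> or in
  \<open>M\<close>, is carried along because it decides which terms of a product vanish.\<close>
proof (induction t)
  case (Var i)
  interpret M: module R M by fact
  have "fst (v i) \<in> carrier A" "snd (v i) \<in> carrier M"
    using v[of i] by auto
  then show ?case
    using Var by (auto simp: e_def e'_def k_def scale_snd_def split_beta Int_insert_left)
next
  case (Prod s t)
  interpret A: module R A by fact
  interpret M: module R M by fact
  note zeros = bilinear_on_zero_left[OF A A A \<mu>] bilinear_on_zero_right[OF A A A \<mu>]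
    bilinear_on_zero_left[OF A M M l] bilinear_on_zero_right[OF A M M l]
    bilinear_on_zero_left[OF A M M r] bilinear_on_zero_right[OF A M M r]
    bilinear_on_zero_left[OF M M M bul] bilinear_on_zero_right[OF M M M bul]
  note closed = bilinear_on_closed[OF \<mu>] bilinear_on_closed[OF l] bilinear_on_closed[OF r]
    bilinear_on_closed[OF bul]
  note smult = bilinear_on_smult_left[OF l] bilinear_on_smult_right[OF l]
    bilinear_on_smult_left[OF r] bilinear_on_smult_right[OF r]
    bilinear_on_smult_left[OF bul] bilinear_on_smult_right[OF bul]
  have e_closed: "fst (e u) \<in> carrier A" "snd (e u) \<in> carrier M" for u
    using eval_monomial_closed[where v = v and t = u, OF bilinear_on_semidirect_product[OF M \<mu> l r bul] v]
    by (auto simp: e_def)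
  obtain a m where s: "e s = (a, m)" "a \<in> carrier A" "m \<in> carrier M"
    using e_closed[of s] by (cases "e s") auto
  obtain a' m' where t: "e t = (a', m')" "a' \<in> carrier A" "m' \<in> carrier M"
    using e_closed[of t] by (cases "e t") auto
  \<comment> \<open>The two factors have disjoint variable sets, so the counts add.\<close>
  have k: "k (Prod s t) = k s + k t"
    unfolding k_def using Prod.prems(1)
    by (subst card_Un_disjoint[symmetric]) (auto intro!: arg_cong[of _ _ card])
  have e: "e (Prod s t) = semidirect_product M \<mu> bul l r (a, m) (a', m')"
    using s t by (simp add: e_def)
  have e': "e' (Prod s t) =
      semidirect_product M \<mu> (\<lambda>m m'. w \<odot>\<^bsub>M\<^esub> bul m m') l r (e' s) (e' t)"
    by (simp add: e'_def)
  have IH: "e' s = (a, w [^]\<^bsub>R\<^esub> (k s - 1) \<odot>\<^bsub>M\<^esub> m)"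
      "if k s = 0 then m = \<zero>\<^bsub>M\<^esub> else a = \<zero>\<^bsub>A\<^esub>"
      "e' t = (a', w [^]\<^bsub>R\<^esub> (k t - 1) \<odot>\<^bsub>M\<^esub> m')"
      "if k t = 0 then m' = \<zero>\<^bsub>M\<^esub> else a' = \<zero>\<^bsub>A\<^esub>"
    using Prod s t by (auto simp: scale_snd_def)
  have pow: "w [^]\<^bsub>R\<^esub> (j::nat) \<in> carrier R" for j using w by simp
  show ?case
  \<comment> \<open>With both counts zero the product stays in \<open>A\<close>. With exactly one
    positive, only an action survives and passes the existing power of \<open>w\<close> through
    unchanged. With both positive, only the product on \<open>M\<close> survives and contributes one
    further \<open>w\<close>.\<close>
  proof (cases "k s")
    case ks: 0
    show ?thesis
    proof (cases "k t")
      case 0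
      with ks show ?thesis using IH s t w
        by (simp add: k e e' semidirect_product_def scale_snd_def zeros closed)
    next
      case (Suc j)
      with ks show ?thesis using IH s t w
        by (simp add: k e e' semidirect_product_def scale_snd_def zeros closed smult pow)
    qed
  next
    case ks: (Suc i)
    show ?thesis
    proof (cases "k t")
      case 0
      with ks show ?thesis using IH s t w
        by (simp add: k e e' semidirect_product_def scale_snd_def zeros closed smult pow)
    next
      case (Suc j)
      \<comment> \<open>Here \<open>k s - 1 = i\<close> and \<open>k t - 1 = j\<close>, so the extra
        \<open>w\<close> gives exactly \<open>k s + k t - 1 = i + Suc j\<close>.\<close>
      have "w [^]\<^bsub>R\<^esub> (i + Suc j) = w \<otimes>\<^bsub>R\<^esub> (w [^]\<^bsub>R\<^esub> j \<otimes>\<^bsub>R\<^esub> w [^]\<^bsub>R\<^esub> i)"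
        using w by (simp add: A.R.nat_pow_mult A.R.m_comm add.commute)
      with Suc ks show ?thesis using IH s t w
        by (simp add: k e e' semidirect_product_def scale_snd_def zeros closed smult pow M.smult_assoc1)
    qed
  qed
qed

text \<open>All monomials of the relation have the same variables, so the number of arguments from
  \<open>M\<close>, and with it the power of \<open>w\<close>, is common to all terms and factors
  out.\<close>

lemma eval_relation_scaled:
  fixes A :: "('r, 'a, 'y) module_scheme" and M :: "('r, 'm, 'z) module_scheme"
  assumes A: "module R A" and M: "module R M"
    and \<mu>: "bilinear_on R A A A \<mu>" and l: "bilinear_on R A M M l" and r: "bilinear_on R A M M r"
    and bul: "bilinear_on R M M M bul" and w: "w \<in> carrier R"
    and v: "\<And>i. v i \<in> carrier (module_sum A M)"
    and "multilinear_relation R n p"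
    and pure: "\<And>i. i \<in> {1..n} \<Longrightarrow> i \<in> S \<Longrightarrow> fst (v i) = \<zero>\<^bsub>A\<^esub>"
      "\<And>i. i \<in> {1..n} \<Longrightarrow> i \<notin> S \<Longrightarrow> snd (v i) = \<zero>\<^bsub>M\<^esub>"
  shows "eval_relation (module_sum A M) (semidirect_product M \<mu> (\<lambda>m m'. w \<odot>\<^bsub>M\<^esub> bul m m') l r) v p =
    scale_snd M (w [^]\<^bsub>R\<^esub> (card ({1..n} \<inter> S) - 1))
      (eval_relation (module_sum A M) (semidirect_product M \<mu> bul l r) v p)"
    (is "?e' p = scale_snd M ?c (?e p)")
  using assms(9)
proof (induction p)
  case Nil
  interpret M: module R M by fact
  show ?case using w by (simp add: scale_snd_def)
next
  case (Cons x p)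
  interpret M: module R M by fact
  obtain c t where x: "x = (c, t)" by force
  have p: "multilinear_relation R n p" and c: "c \<in> carrier R"
    and t: "distinct (vars t)" "set (vars t) = {1..n}"
    using Cons.prems by (auto simp: x multilinear_relation_Cons)
  note b = bilinear_on_semidirect_product[OF M \<mu> l r bul]
  obtain a m where am: "eval_monomial (semidirect_product M \<mu> bul l r) v t = (a, m)"
    "a \<in> carrier A" "m \<in> carrier M"
    using eval_monomial_closed[where v = v and t = t, OF b v] by auto
  obtain a' m' where am': "?e p = (a', m')" "a' \<in> carrier A" "m' \<in> carrier M"
    using eval_relation_closed[where v = v, OF module_module_sum[OF A M] b v p] by auto
  have "eval_monomial (semidirect_product M \<mu> (\<lambda>m m'. w \<odot>\<^bsub>M\<^esub> bul m m') l r) v t =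
      scale_snd M ?c (a, m)"
    using eval_monomial_scaled[where v = v and S = S, OF A M \<mu> l r bul w v t(1)] pure t(2) am(1) by simp
  moreover have "?e' p = scale_snd M ?c (a', m')"
    using Cons.IH[OF p] am'(1) by simp
  moreover have "?c \<otimes>\<^bsub>R\<^esub> c = c \<otimes>\<^bsub>R\<^esub> ?c"
    using c w by (simp add: M.R.m_comm)
  ultimately show ?case
    using am am' c w by (simp add: x scale_snd_def M.smult_r_distr flip: M.smult_assoc1)
qed

text \<open>At pure arguments the value for the rescaled product is \<open>scale_snd\<close> of a
  value that vanishes by assumption; bilinearity extends this to all arguments.\<close>

lemma in_category_scaled_semidirect_product:
  fixes A :: "('r, 'a, 'y) module_scheme" and M :: "('r, 'm, 'z) module_scheme"
  assumes Rs: "\<forall>p\<in>set Rs. \<exists>n. multilinear_relation R n p"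
    and A: "in_category R Rs A \<mu>"
    and M: "bimodule_algebra R Rs A \<mu> M bul l r" and w: "w \<in> carrier R"
  shows "in_category R Rs (module_sum A M) (semidirect_product M \<mu> (\<lambda>m m'. w \<odot>\<^bsub>M\<^esub> bul m m') l r)"
proof -
  have mod: "module R A" "module R M" and \<mu>: "bilinear_on R A A A \<mu>"
    and l: "bilinear_on R A M M l" and r: "bilinear_on R A M M r" and bul: "bilinear_on R M M M bul"
    and semi: "in_category R Rs (module_sum A M) (semidirect_product M \<mu> bul l r)"
    using A M by (auto simp: in_category_def bimodule_algebra_def nonassoc_algebra_def)
  interpret M: module R M by (rule mod)
  let ?\<mu> = "semidirect_product M \<mu> (\<lambda>m m'. w \<odot>\<^bsub>M\<^esub> bul m m') l r"
  have b: "bilinear_on R (module_sum A M) (module_sum A M) (module_sum A M) ?\<mu>"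
    by (intro bilinear_on_semidirect_product bilinear_on_scale mod \<mu> l r bul w)
  have "eval_relation (module_sum A M) ?\<mu> v p = \<zero>\<^bsub>module_sum A M\<^esub>"
    if p: "p \<in> set Rs" "multilinear_relation R n p" and v: "\<And>i. v i \<in> carrier (module_sum A M)"
    for p n v
  proof (rule eval_relation_module_sum_pure[OF mod b p(2) _ v])
    fix v
    assume v: "\<And>i. v i \<in> carrier (module_sum A M)"
      and pure: "\<And>i. i \<in> {1..n} \<Longrightarrow> fst (v i) = \<zero>\<^bsub>A\<^esub> \<or> snd (v i) = \<zero>\<^bsub>M\<^esub>"
    have "eval_relation (module_sum A M) (semidirect_product M \<mu> bul l r) v p = \<zero>\<^bsub>module_sum A M\<^esub>"
      using semi p(1) v unfolding in_category_def by blast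
    \<comment> \<open>Positions with zero \<open>A\<close>-component, including those where both
      components vanish, form \<open>S\<close>; at every other position in \<open>{1..n}\<close>
      purity forces the \<open>M\<close>-component to be zero.\<close>
    then show "eval_relation (module_sum A M) ?\<mu> v p = \<zero>\<^bsub>module_sum A M\<^esub>"
      using eval_relation_scaled[where v = v and S = "{i. fst (v i) = \<zero>\<^bsub>A\<^esub>}",
          OF mod \<mu> l r bul w v p(2)] pure w
      by (auto simp: scale_snd_def)
  qed
  then show ?thesis
    using Rs b module_module_sum[OF mod]
    by (auto simp: in_category_def nonassoc_algebra_def)
qed

section \<open>The NS-algebra of a relative Rota-Baxter operator\<close>

theorem proposition5p4:
  fixes R :: "('r, 'x) ring_scheme"
    and Rs :: "'r relation list"
    and A :: "('r, 'a, 'y) module_scheme" and \<mu> :: "'a \<Rightarrow> 'a \<Rightarrow> 'a"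
    and M :: "('r, 'm, 'z) module_scheme" and bul :: "'m \<Rightarrow> 'm \<Rightarrow> 'm"
    and l r :: "'a \<Rightarrow> 'm \<Rightarrow> 'm"
    and w :: 'r and \<RR> :: "'m \<Rightarrow> 'a"
  assumes "cring R"
    and "\<forall>p\<in>set Rs. \<exists>n. multilinear_relation R n p"
    and "in_category R Rs A \<mu>"
    and "bimodule_algebra R Rs A \<mu> M bul l r"
    and "w \<in> carrier R"
    and "relative_Rota_Baxter R A \<mu> M bul l r w \<RR>"
  shows "NS_algebra R Rs M
    (\<lambda>m m'. r (\<RR> m') m)
    (\<lambda>m m'. l (\<RR> m) m')
    (\<lambda>m m'. w \<odot>\<^bsub>M\<^esub> bul m m')"
proof -
  have A: "module R A" and M: "module R M" and \<mu>: "bilinear_on R A A A \<mu>"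
    and l: "bilinear_on R A M M l" and r: "bilinear_on R A M M r" and bul: "bilinear_on R M M M bul"
    using assms(3,4) by (auto simp: in_category_def bimodule_algebra_def nonassoc_algebra_def)
  interpret A: module R A by fact
  interpret M: module R M by fact
  have \<RR>: "linear_on R M A \<RR>"
    and RB: "\<And>m m'. m \<in> carrier M \<Longrightarrow> m' \<in> carrier M \<Longrightarrow>
      \<mu> (\<RR> m) (\<RR> m') = \<RR> (l (\<RR> m) m' \<oplus>\<^bsub>M\<^esub> r (\<RR> m') m \<oplus>\<^bsub>M\<^esub> w \<odot>\<^bsub>M\<^esub> bul m m')"
    using assms(6) by (auto simp: relative_Rota_Baxter_def)
  note sum_A = module_module_sum[OF A M] and sum_M = module_module_sum[OF M M]
  note closed = linear_on_closed[OF \<RR>] bilinear_on_closed[OF l] bilinear_on_closed[OF r]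
    bilinear_on_closed[OF bul]
  have prec: "bilinear_on R M M M (\<lambda>m m'. r (\<RR> m') m)"
    by (rule bilinear_on_flip[OF bilinear_on_compose[OF r \<RR> linear_on_id]])
  have succ: "bilinear_on R M M M (\<lambda>m m'. l (\<RR> m) m')"
    by (rule bilinear_on_compose[OF l \<RR> linear_on_id])
  have vee: "bilinear_on R M M M (\<lambda>m m'. w \<odot>\<^bsub>M\<^esub> bul m m')"
    by (rule bilinear_on_scale[OF M bul assms(5)])
  \<comment> \<open>The summands of the first component stand in the order of the Rota-Baxter
    identity, which therefore says that \<RR> sends this product on \<open>M\<close> to
    \<mu>.\<close>
  define box where "box = (\<lambda>(a, x) (a', x').
    (l (\<RR> a) a' \<oplus>\<^bsub>M\<^esub> r (\<RR> a') a \<oplus>\<^bsub>M\<^esub> w \<odot>\<^bsub>M\<^esub> bul a a', l (\<RR> a) x' \<oplus>\<^bsub>M\<^esub> r (\<RR> a') x))"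
  have box_eq: "box = (\<lambda>u u'.
      (l (\<RR> (fst u)) (fst u') \<oplus>\<^bsub>M\<^esub> r (\<RR> (fst u')) (fst u) \<oplus>\<^bsub>M\<^esub> w \<odot>\<^bsub>M\<^esub> bul (fst u) (fst u'),
       l (\<RR> (fst u)) (snd u') \<oplus>\<^bsub>M\<^esub> r (\<RR> (fst u')) (snd u)))"
    by (auto simp: box_def fun_eq_iff)
  have box: "bilinear_on R (module_sum M M) (module_sum M M) (module_sum M M) box"
    unfolding box_eq
    by (intro bilinear_on_Pair bilinear_on_plus M
        bilinear_on_compose[OF succ linear_on_fst linear_on_fst]
        bilinear_on_compose[OF prec linear_on_fst linear_on_fst]
        bilinear_on_compose[OF vee linear_on_fst linear_on_fst]
        bilinear_on_compose[OF succ linear_on_fst linear_on_snd]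
        bilinear_on_compose[OF prec linear_on_snd linear_on_fst])
  have "eval_relation (module_sum M M) box v p = \<zero>\<^bsub>module_sum M M\<^esub>"
    if "p \<in> set Rs" and v: "\<And>i. v i \<in> carrier (module_sum M M)" for p v
  proof -
    obtain n where p: "multilinear_relation R n p"
      using assms(2) \<open>p \<in> set Rs\<close> by blast
    \<comment> \<open>Neither map alone needs to be injective: \<open>?f\<close> records the first
      component of \<open>u\<close> and \<open>?g\<close> the second.\<close>
    let ?f = "\<lambda>u. (\<RR> (fst u), fst u)" and ?g = "\<lambda>u. (\<RR> (fst u), snd u)"
    let ?e = "eval_relation (module_sum M M) box v p"
    have f: "linear_on R (module_sum M M) (module_sum A M) ?f"
      and g: "linear_on R (module_sum M M) (module_sum A M) ?g"
      by (intro linear_on_Pair linear_on_compose[OF linear_on_fst \<RR>] linear_on_fst linear_on_snd)+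
    have relation_zero: "eval_relation (module_sum A M)
        (semidirect_product M \<mu> (\<lambda>m m'. c \<odot>\<^bsub>M\<^esub> bul m m') l r) v' p = \<zero>\<^bsub>module_sum A M\<^esub>"
      if "c \<in> carrier R" "\<And>i. v' i \<in> carrier (module_sum A M)" for c v'
      using in_category_scaled_semidirect_product[OF assms(2-4) that(1)] \<open>p \<in> set Rs\<close> that(2)
      unfolding in_category_def by blast
    \<comment> \<open>For \<open>?f\<close> the \<open>M\<close>-component of the product in the
      target is the first component of \<open>box\<close>, including its
      \<open>w\<close>-term.\<close>
    have "?f ?e = eval_relation (module_sum A M)
        (semidirect_product M \<mu> (\<lambda>m m'. w \<odot>\<^bsub>M\<^esub> bul m m') l r) (\<lambda>i. ?f (v i)) p"
      by (rule eval_relation_hom[OF sum_M sum_A box v f _ p])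
        (auto simp: box_def semidirect_product_def RB)
    \<comment> \<open>The second component of \<open>box\<close> contains only the two actions, so
      the product on \<open>M\<close> has to be switched off: the weight is \<open>0\<close>,
      whatever \<open>w\<close> is.\<close>
    moreover have "?g ?e = eval_relation (module_sum A M)
        (semidirect_product M \<mu> (\<lambda>m m'. \<zero>\<^bsub>R\<^esub> \<odot>\<^bsub>M\<^esub> bul m m') l r) (\<lambda>i. ?g (v i)) p"
      by (rule eval_relation_hom[OF sum_M sum_A box v g _ p])
        (auto simp: box_def semidirect_product_def RB closed)
    ultimately have "?f ?e = \<zero>\<^bsub>module_sum A M\<^esub>" "?g ?e = \<zero>\<^bsub>module_sum A M\<^esub>"
      using relation_zero[OF assms(5) linear_on_closed[OF f v]]
        relation_zero[OF A.R.zero_closed linear_on_closed[OF g v]] by simp_all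
    \<comment> \<open>The \<open>M\<close>-components of the two images are the two components of
      \<open>?e\<close>, so both are zero.\<close>
    then show ?thesis by (simp add: prod_eq_iff)
  qed
  then have "in_category R Rs (module_sum M M) box"
    using box sum_M by (auto simp: in_category_def nonassoc_algebra_def)
  then show ?thesis
    using M prec succ vee by (simp add: NS_algebra_def nonassoc_algebra_def box_def)
qed

end
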